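(* For any block $B\in\mathcal L(\zeta)$, any $\alpha\in(0,1)$, and any sequence of integers $(k_n)$ with $0\le k_n\le n$, $k_n\to\infty$ and $k_n/n\to\alpha$, we have $$\lim_{n\to\infty}\operatorname{freq}(B,B_{n,k_n})=\nu_\alpha(B).$$
   Context: Basic blocks: for $n\ge 1$ and $0\le k\le n$ define words $B_{n,k}$ over $\{a,b\}$ by $B_{n,n}=b$, $B_{n,0}=a$ for all $n\ge 1$, and $B_{n,k}=B_{n-1,k}B_{n-1,k-1}$ (concatenation) for $n\ge 2$, $0<k<n$. $\mathcal L(\zeta)$ is the set of all (nonempty) subwords (contiguous factors) of the words $B_{n,k}$. $\Sigma$ is the set of all sequences in $\{a,b\}^{\mathbb Z}$ all of whose finite subwords belong to $\mathcal L(\zeta)$, with shift $\sigma$. For words $B,C$, $\operatorname{freq}(B,C)$ is the number of occurrences (possibly overlapping) of $B$ in $C$ divided by the length of $C$. Measures: let $X=\{0,1\}^{\mathbb N}$, with sequences $x=x_1x_2\dots$. Pascal adic: let $X_{\max}=\{0^i1^\infty: i\ge 1\}\cup\{0^\infty,1^\infty\}$. Every $x\in X\setminus X_{\max}$ can be written uniquely as $x=0^r1^s10x'$ with $r,s\ge 0$, $x'\in\{0,1\}^{\mathbb N}$, and $T(0^r1^s10x')=1^s0^r01x'$; $T$ is extended to a bijection of $X$ by $T(0^i1^\infty)=1^i0^\infty$ for $i\ge 1$, $T(0^\infty)=0^\infty$, $T(1^\infty)=1^\infty$. Let $X'$ be the countable set of sequences that are eventually constant. Define $\phi:X\setminus X'\to\Sigma$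 by $\phi(x)=(\omega_i)_{i\in\mathbb Z}$, where $\omega_i=a$ if the first coordinate of $T^ix$ is $0$ and $\omega_i=b$ if it is $1$. Let $\mu_\alpha$ be the product measure on $X$ giving, in each coordinate, mass $\alpha$ to the symbol $1$ and $1-\alpha$ to the symbol $0$, and let $\nu_\alpha=\mu_\alpha\circ\phi^{-1}$. For a word $B$ of length $m$, $\nu_\alpha(B)$ denotes $\nu_\alpha\{\omega\in\Sigma:\omega_0\omega_1\cdots\omega_{m-1}=B\}$. *)

theory Defs
  imports "HOL-Probability.Probability" "HOL-Library.Sublist"
begin

datatype letter = La | Lb

text \<open>Only the values with \<open>1 \<le> n\<close> and \<open>k \<le> n\<close> are meaningful.\<close>

fun block :: "nat \<Rightarrow> nat \<Rightarrow> letter list" where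
  "block n k =
     (if k = 0 then [La]
      else if n \<le> k then [Lb]
      else block (n - 1) k @ block (n - 1) (k - 1))"

declare block.simps [simp del]

definition lang :: "letter list set" where
  "lang = {w. w \<noteq> [] \<and> (\<exists>n k. 1 \<le> n \<and> k \<le> n \<and> sublist w (block n k))}"

definition window :: "(int \<Rightarrow> 'c) \<Rightarrow> int \<Rightarrow> nat \<Rightarrow> 'c list" where
  "window \<omega> i m = map (\<lambda>j. \<omega> (i + int j)) [0..<m]"

definition Sigma_shift :: "(int \<Rightarrow> letter) set" where
  "Sigma_shift = {\<omega>. \<forall>i m. 1 \<le> m \<longrightarrow> window \<omega> i m \<in> lang}"

definition freq :: "'c list \<Rightarrow> 'c list \<Rightarrow> real" where
  "freq B C =
     real (card {i. i + length B \<le> length C \<and> take (length B) (drop i C) = B})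
       / real (length C)"

text \<open>The symbols 0 and 1 are \<^term>\<open>False\<close> and \<^term>\<open>True\<close>; a sequence
  \<open>x\<^sub>1x\<^sub>2\<dots>\<close> is a stream whose head is the first coordinate.\<close>

inductive pascal_step :: "bool stream \<Rightarrow> bool stream \<Rightarrow> bool" where
  step: "pascal_step
     (replicate r False @- replicate s True @- True ## False ## x')
     (replicate s True @- replicate r False @- False ## True ## x')"
| maximal: "1 \<le> i \<Longrightarrow> pascal_step
     (replicate i False @- sconst True) (replicate i True @- sconst False)"
| zeros: "pascal_step (sconst False) (sconst False)"
| ones: "pascal_step (sconst True) (sconst True)"

definition pascal_adic :: "bool stream \<Rightarrow> bool stream" where
  "pascal_adic x = (THE y. pascal_step x y)"

definition int_iterate :: "('x \<Rightarrow> 'x) \<Rightarrow> int \<Rightarrow> 'x \<Rightarrow> 'x" where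
  "int_iterate f i =
     (if 0 \<le> i then f ^^ nat i else inv f ^^ nat (- i))"

lemma replicate_shift_inject:
  "c \<noteq> d \<Longrightarrow> replicate r c @- d ## u = replicate r' c @- d ## v \<Longrightarrow> r = r' \<and> u = v"
proof (induction r arbitrary: r')
  case 0
  then show ?case by (cases r') auto
next
  case (Suc r)
  then show ?case by (cases r') auto
qed

lemma sconst_unfold: "sconst c = c ## sconst c"
  by (metis id_apply siterate.code)

lemma replicate_shift_neq_sconst:
  assumes "c \<noteq> d"
  shows "replicate r c @- d ## u \<noteq> sconst c"
proof
  assume "replicate r c @- d ## u = sconst c"
  then have "(replicate r c @- d ## u) !! r = sconst c !! r" by simp
  then show False using assms by simp
qed

lemma replicate_shift_or_sconst:
  "x = sconst c \<or> (\<exists>r d u. d \<noteq> c \<and> x = replicate r c @- d ## u)"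
proof (cases "\<exists>n. x !! n \<noteq> c")
  case True
  define r where "r = (LEAST n. x !! n \<noteq> c)"
  have r: "x !! r \<noteq> c" "\<And>j. j < r \<Longrightarrow> x !! j = c"
    using True LeastI_ex[of "\<lambda>n. x !! n \<noteq> c"] not_less_Least[of _ "\<lambda>n. x !! n \<noteq> c"]
    unfolding r_def by auto
  have "stake r x = replicate r c"
    by (rule nth_equalityI) (auto simp: r)
  then have "x = replicate r c @- x !! r ## sdrop (Suc r) x"
    by (metis id_stake_snth_sdrop)
  then show ?thesis using r by blast
next
  case False
  then have "sset x = {c}"
    unfolding sset_range by auto
  then have "x = sconst c"
    by (simp add: sconst_alt)
  then show ?thesis by blast
qed

lemma replicate_True_bump:
  "replicate s True @- True ## u = True ## (replicate s True @- u)"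
  by (induction s) auto

text \<open>\<^const>\<open>pascal_step\<close> is the graph of a bijection, so \<^const>\<open>pascal_adic\<close> is well
  defined and its inverse makes sense.\<close>

lemma pascal_step_total: "\<exists>y. pascal_step x y"
proof (cases "x = sconst False")
  case True
  then show ?thesis using zeros by blast
next
  case False
  then obtain r u where x: "x = replicate r False @- True ## u"
    using replicate_shift_or_sconst[of x False] by auto
  show ?thesis
  proof (cases "u = sconst True")
    case True
    then have x': "x = replicate r False @- sconst True"
      using x sconst_unfold[of True] by simp
    show ?thesis
    proof (cases r)
      case 0
      then show ?thesis using x' ones by auto
    next
      case (Suc n)
      then show ?thesis using x' maximal[of r] by auto
    qed
  next
    case False
    then obtain s v where "u = replicate s True @- False ## v"
      using replicate_shift_or_sconst[of u True] by auto
    then have "x = replicate r False @- replicate s True @- True ## False ## v"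
      using x by (simp add: replicate_True_bump)
    then show ?thesis using step by blast
  qed
qed

lemma pascal_step_normal_form:
  assumes "pascal_step x y"
  shows "(x = sconst False \<and> y = sconst False)
    \<or> (\<exists>r u. x = replicate r False @- True ## u
          \<and> (u = sconst True \<and> y = (if r = 0 then sconst True else replicate r True @- sconst False)
            \<or> (\<exists>s v. u = replicate s True @- False ## v
                  \<and> y = replicate s True @- replicate r False @- False ## True ## v)))"
  using assms
proof cases
  case (step r s x')
  then show ?thesis by (metis replicate_True_bump)
next
  case (maximal i)
  then show ?thesis by (metis sconst_unfold not_one_le_zero)
next
  case zeros
  then show ?thesis by blast
next
  case ones
  then show ?thesis by (metis sconst_unfold replicate_0 shift.simps(1))
qed

lemma pascal_step_functional:
  assumes "pascal_step x y" "pascal_step x y'"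
  shows "y = y'"
proof (cases "x = sconst False")
  case True
  then show ?thesis
    using pascal_step_normal_form[OF assms(1)] pascal_step_normal_form[OF assms(2)]
      replicate_shift_neq_sconst[of False True]
    by metis
next
  case False
  then obtain r u where x: "x = replicate r False @- True ## u"
    using replicate_shift_or_sconst[of x False] by auto
  have *: "u = sconst True \<and> z = (if r = 0 then sconst True else replicate r True @- sconst False)
            \<or> (\<exists>s v. u = replicate s True @- False ## v
                  \<and> z = replicate s True @- replicate r False @- False ## True ## v)"
    if z: "pascal_step x z" for z
    using pascal_step_normal_form[OF z] False x replicate_shift_inject[of False True]
    by metis
  show ?thesis
  proof (cases "u = sconst True")
    case True
    then show ?thesis
      using *[OF assms(1)] *[OF assms(2)] replicate_shift_neq_sconst[of True False] by metis
  next
    case False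
    then show ?thesis
      using *[OF assms(1)] *[OF assms(2)] replicate_shift_inject[of True False] by metis
  qed
qed

lemma smap_shift: "smap f (xs @- u) = map f xs @- smap f u"
  by (induction xs) auto

lemma smap_sconst: "smap f (sconst c) = sconst (f c)"
  by (simp add: stream.map_ident_strong sconst_alt stream.set_map)

lemma pascal_step_flip:
  assumes "pascal_step x y"
  shows "pascal_step (smap Not y) (smap Not x)"
  using assms
proof cases
  case (step r s x')
  then show ?thesis
    using pascal_step.step[of s r "smap Not x'"] by (simp add: smap_shift)
next
  case (maximal i)
  then show ?thesis
    using pascal_step.maximal[of i] by (simp add: smap_shift smap_sconst)
next
  case zeros
  then show ?thesis using pascal_step.ones by (simp add: smap_sconst)
next
  case ones
  then show ?thesis using pascal_step.zeros by (simp add: smap_sconst)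
qed

lemma pascal_adic_eq_iff: "pascal_adic x = y \<longleftrightarrow> pascal_step x y"
  unfolding pascal_adic_def
  by (metis pascal_step_functional pascal_step_total the_equality)

lemma bij_pascal_adic: "bij pascal_adic"
proof (rule bijI')
  have Not_Not: "smap Not (smap Not x) = x" for x
    by (simp add: stream.map_comp comp_def stream.map_ident)
  show "pascal_adic x = pascal_adic y \<longleftrightarrow> x = y" for x y
    by (metis Not_Not pascal_adic_eq_iff pascal_step_flip pascal_step_functional)
  show "\<exists>x. y = pascal_adic x" for y
    by (metis Not_Not pascal_adic_eq_iff pascal_step_flip pascal_step_total)
qed

definition eventually_constant :: "bool stream set" where
  "eventually_constant = {x. \<exists>n c. sdrop n x = sconst c}"

definition phi :: "bool stream \<Rightarrow> int \<Rightarrow> letter" where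
  "phi x = (\<lambda>i. if shd (int_iterate pascal_adic i x) then Lb else La)"

definition mu :: "real \<Rightarrow> bool stream measure" where
  "mu \<alpha> = stream_space (measure_pmf (bernoulli_pmf \<alpha>))"

definition Sigma_space :: "(int \<Rightarrow> letter) measure" where
  "Sigma_space = restrict_space (PiM UNIV (\<lambda>_. count_space UNIV)) Sigma_shift"

text \<open>\<^const>\<open>phi\<close> is only considered off the (null) set of eventually constant sequences.\<close>

definition nu :: "real \<Rightarrow> (int \<Rightarrow> letter) measure" where
  "nu \<alpha> = distr (restrict_space (mu \<alpha>) (- eventually_constant)) Sigma_space phi"

definition nu_word :: "real \<Rightarrow> letter list \<Rightarrow> real" where
  "nu_word \<alpha> B = measure (nu \<alpha>) {\<omega> \<in> Sigma_shift. window \<omega> 0 (length B) = B}"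

end

(* List the 0-1 words of length n with k ones in the order in which the Pascal adic
   runs through their cylinders; reading off first letters gives B_{n,k}.  Hence, on
   the cylinder of the word at position p, the coding phi x agrees with B_{n,k} read
   from p, and nu_alpha(B) lies between the two sums over j of
   alpha^j (1-alpha)^(n-j) times the number of occurrences of B in B_{n,j}, counted
   without (lower bound) or with (upper bound) partial occurrences at the right end.
   For fixed N, B_{n,k} is a concatenation of binomial(n-N, k-j) copies of each
   B_{N,j}, so the frequency lies between the same sums for N, with the weights
   binomial(n-N, k-j) / binomial(n, k), which tend to alpha^j (1-alpha)^(N-j).
   The upper and lower sums differ by at most |B| times the sum of the weights
   alpha^j (1-alpha)^(N-j), which vanishes as N tends to infinity. *)
theory Submission
  imports Defs
begin

section \<open>Paths in the Pascal graph and the adic transformation\<close>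

text \<open>The order of the list is the order of the Pascal adic: compare last letters first.\<close>

fun paths :: "nat \<Rightarrow> nat \<Rightarrow> bool list list" where
  "paths 0 0 = [[]]"
| "paths 0 (Suc k) = []"
| "paths (Suc n) 0 = map (\<lambda>w. w @ [False]) (paths n 0)"
| "paths (Suc n) (Suc k) =
     map (\<lambda>w. w @ [False]) (paths n (Suc k)) @ map (\<lambda>w. w @ [True]) (paths n k)"

lemma length_paths: "length (paths n k) = n choose k"
  by (induction n k rule: paths.induct) auto

lemma paths_eq_Nil_iff: "paths n k = [] \<longleftrightarrow> n < k"
  by (metis length_0_conv length_paths binomial_eq_0_iff)

lemma set_paths: "set (paths n k) = {w. length w = n \<and> count_list w True = k}"
proof (induction n arbitrary: k)
  case 0
  show ?case by (cases k) auto
next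
  case (Suc n)
  have snoc: "length w = Suc n \<longleftrightarrow> (\<exists>v b. w = v @ [b] \<and> length v = n)" for w :: "bool list"
    by (cases w rule: rev_cases) auto
  show ?case
  proof (cases k)
    case 0
    then show ?thesis by (auto simp: Suc snoc image_iff)
  next
    case (Suc k')
    then show ?thesis by (auto simp: Suc.IH snoc image_iff split: if_splits)
  qed
qed

lemma distinct_paths: "distinct (paths n k)"
  by (induction n k rule: paths.induct) (auto simp: distinct_map inj_on_def)

text \<open>\<open>hd_paths\<close> and \<open>last_paths\<close> supply the two words that meet
  where the halves of the recursion for \<open>paths\<close> are glued in
  \<open>successively_paths\<close>.\<close>

lemma hd_paths: "k \<le> n \<Longrightarrow> hd (paths n k) = replicate k True @ replicate (n - k) False"
proof (induction n arbitrary: k)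
  case (Suc n)
  show ?case
  proof (cases k)
    case 0
    then show ?thesis using Suc by (auto simp: hd_map paths_eq_Nil_iff replicate_append_same)
  next
    case (Suc k')
    show ?thesis
    \<comment> \<open>For \<open>k' = n\<close> the first half of the recursion is empty, so the
      head comes from the second half.\<close>
    proof (cases "k' = n")
      case True
      then show ?thesis using Suc Suc.IH[of k'] True Suc.prems
        by (auto simp: hd_map hd_append paths_eq_Nil_iff replicate_append_same)
    next
      case False
      then show ?thesis using Suc Suc.IH[of "Suc k'"] Suc.prems
        by (auto simp: hd_map hd_append paths_eq_Nil_iff replicate_append_same
            simp flip: replicate_Suc Suc_diff_Suc)
    qed
  qed
qed auto

lemma last_paths: "k \<le> n \<Longrightarrow> last (paths n k) = replicate (n - k) False @ replicate k True"
proof (induction n arbitrary: k)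
  case (Suc n)
  show ?case
  proof (cases k)
    case 0
    then show ?thesis using Suc by (auto simp: last_map paths_eq_Nil_iff replicate_append_same)
  next
    case (Suc k')
    then show ?thesis using Suc.IH[of k'] Suc.prems
      by (auto simp: last_map last_append paths_eq_Nil_iff replicate_append_same)
  qed
qed auto

text \<open>Finite counterpart of the rule \<open>pascal_step.step\<close> alone; the other rules
  involve an infinite constant tail and cannot be seen on a finite word.\<close>

definition word_step :: "bool list \<Rightarrow> bool list \<Rightarrow> bool" where
  "word_step w w' \<longleftrightarrow> (\<exists>r s v.
     w = replicate r False @ replicate s True @ True # False # v
   \<and> w' = replicate s True @ replicate r False @ False # True # v)"

lemma word_step_append: "word_step w w' \<Longrightarrow> word_step (w @ u) (w' @ u)"
  unfolding word_step_def by (metis append.assoc append_Cons)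

lemma pascal_adic_word_step:
  assumes "word_step w w'"
  shows "pascal_adic (w @- z) = w' @- z"
  using assms unfolding word_step_def pascal_adic_eq_iff
  using pascal_step.step by fastforce

text \<open>Inside each half a step survives appending a letter. At the junction the step is
  \<open>0^(n-k-1) 1^(k+1) 0\<close> to \<open>1^k 0^(n-k) 1\<close>, an instance of the rule with
  empty tail \<open>v\<close>.\<close>

lemma successively_paths: "successively word_step (paths n k)"
proof (induction n k rule: paths.induct)
  case (3 n)
  show ?case
    unfolding paths.simps successively_map
    by (rule successively_mono[OF 3]) (auto intro: word_step_append)
next
  case (4 n k)
  have a: "successively word_step (map (\<lambda>w. w @ [False]) (paths n (Suc k)))"
    unfolding successively_map
    by (rule successively_mono[OF 4(1)]) (auto intro: word_step_append)
  have b: "successively word_step (map (\<lambda>w. w @ [True]) (paths n k))"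
    unfolding successively_map
    by (rule successively_mono[OF 4(2)]) (auto intro: word_step_append)
  have "word_step (last (paths n (Suc k)) @ [False]) (hd (paths n k) @ [True])"
    if "paths n (Suc k) \<noteq> []"
  proof -
    have k: "Suc k \<le> n"
      using that by (simp add: paths_eq_Nil_iff)
    have "replicate (n - k) False = replicate (n - Suc k) False @ [False]"
      using k by (metis Suc_diff_Suc Suc_le_lessD replicate_append_same replicate_Suc)
    then show ?thesis
      using k unfolding word_step_def
      by (intro exI[of _ "n - Suc k"] exI[of _ k] exI[of _ "[]"])
         (auto simp: last_paths hd_paths replicate_append_same)
  qed
  then show ?case
    using a b by (auto simp: successively_append_iff last_map hd_map paths_eq_Nil_iff)
qed auto

section \<open>Basic blocks read off from the path lists\<close>

text \<open>Unlike \<open>block\<close>, which yields \<open>[Lb]\<close> for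
  \<open>0 < n < k\<close>, this word is empty there, so the concatenation rule
  \<open>block_of_paths_Suc\<close> holds for every \<open>k\<close>.\<close>

definition block_of_paths :: "nat \<Rightarrow> nat \<Rightarrow> letter list" where
  "block_of_paths n k = map (\<lambda>w. if hd w then Lb else La) (paths n k)"

lemma length_block_of_paths: "length (block_of_paths n k) = n choose k"
  by (simp add: block_of_paths_def length_paths)

lemma length_in_paths: "w \<in> set (paths n k) \<Longrightarrow> length w = n"
  by (simp add: set_paths)

lemma block_of_paths_0:
  assumes "1 \<le> n"
  shows "block_of_paths (Suc n) 0 = block_of_paths n 0"
  using assms unfolding block_of_paths_def
  by (auto simp: hd_append dest!: length_in_paths)

text \<open>Appending a letter leaves the first letter of a nonempty path alone; this is where
  \<open>1 \<le> n\<close> enters.\<close>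

lemma block_of_paths_Suc:
  assumes "1 \<le> n"
  shows "block_of_paths (Suc n) (Suc k) = block_of_paths n (Suc k) @ block_of_paths n k"
  using assms unfolding block_of_paths_def
  by (auto simp: hd_append dest!: length_in_paths)

lemma block_of_paths_eq_Nil: "n < k \<Longrightarrow> block_of_paths n k = []"
  using length_block_of_paths[of n k] by (simp add: binomial_eq_0)

lemma block_eq:
  assumes "1 \<le> n" "k \<le> n"
  shows "block n k = block_of_paths n k"
  using assms
proof (induction n arbitrary: k rule: dec_induct)
  case base
  then consider "k = 0" | "k = 1" by linarith
  then show ?case by cases (auto simp: block.simps block_of_paths_def)
next
  case (step n)
  show ?case
  proof (cases k)
    case 0
    then show ?thesis
      using step.IH[of 0] step.hyps by (simp add: block.simps block_of_paths_0)
  next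
    case (Suc k')
    show ?thesis
    \<comment> \<open>On the diagonal \<open>block\<close> stops at \<open>[Lb]\<close>; the path
      recursion gives the same word because its first factor is empty.\<close>
    proof (cases "k' = n")
      case True
      then show ?thesis
        using Suc step.IH[of n] step.hyps
        by (simp add: block.simps block_of_paths_Suc block_of_paths_eq_Nil)
    next
      case False
      then show ?thesis
        using Suc step.IH[of k'] step.IH[of "Suc k'"] step.hyps step.prems
        by (simp add: block_of_paths_Suc block.simps[of "Suc n"])
    qed
  qed
qed

section \<open>Adic orbits along a path list\<close>

lemma pascal_adic_paths:
  assumes "Suc p < length (paths n k)"
  shows "pascal_adic (paths n k ! p @- z) = paths n k ! Suc p @- z"
  using successively_paths[of n k] assms
  by (auto simp: successively_conv_nth intro: pascal_adic_word_step)

lemma pascal_adic_funpow_paths: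
  assumes "p + i < length (paths n k)"
  shows "(pascal_adic ^^ i) (paths n k ! p @- z) = paths n k ! (p + i) @- z"
  using assms by (induction i) (auto simp: pascal_adic_paths)

lemma inv_pascal_adic_funpow_paths:
  assumes "p + i < length (paths n k)"
  shows "(inv pascal_adic ^^ i) (paths n k ! (p + i) @- z) = paths n k ! p @- z"
  using assms
proof (induction i)
  case (Suc i)
  have "inv pascal_adic (paths n k ! Suc (p + i) @- z) = paths n k ! (p + i) @- z"
    using pascal_adic_paths[of "p + i" n k z] Suc.prems bij_is_inj[OF bij_pascal_adic]
    by (simp add: inv_f_eq)
  then show ?case using Suc by (simp add: funpow_swap1)
qed simp

lemma int_iterate_paths:
  assumes "p < length (paths n k)" "0 \<le> int p + i" "int p + i < int (length (paths n k))"
  shows "int_iterate pascal_adic i (paths n k ! p @- z) = paths n k ! nat (int p + i) @- z"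
proof (cases "0 \<le> i")
  case True
  then show ?thesis
    using pascal_adic_funpow_paths[of p "nat i" n k z] assms
    by (simp add: int_iterate_def nat_add_distrib)
next
  case False
  moreover have "nat (int p + i) + nat (- i) = p" using False assms by linarith
  ultimately show ?thesis
    using inv_pascal_adic_funpow_paths[of "nat (int p + i)" "nat (- i)" n k z] assms
    by (simp add: int_iterate_def)
qed

section \<open>Position of a sequence in the path lists\<close>

text \<open>Both indices are determined by \<open>x\<close> and \<open>n\<close>: \<open>k\<close>
  must be the number of ones among the first \<open>n\<close> letters, and \<open>p\<close> is
  unique because the list is distinct.\<close>

definition at_position :: "bool stream \<Rightarrow> nat \<Rightarrow> nat \<Rightarrow> nat \<Rightarrow> bool" where
  "at_position x n k p \<longleftrightarrow> p < length (paths n k) \<and> stake n x = paths n k ! p"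

lemma at_position_exists: "\<exists>k p. at_position x n k p \<and> k \<le> n"
proof -
  have "stake n x \<in> set (paths n (count_list (stake n x) True))"
    by (simp add: set_paths)
  moreover have "count_list (stake n x) True \<le> n"
    using count_le_length[of "stake n x" True] by simp
  ultimately show ?thesis
    unfolding at_position_def by (metis in_set_conv_nth)
qed

lemma at_position_le: "at_position x n k p \<Longrightarrow> k \<le> n"
  unfolding at_position_def length_paths by (metis binomial_eq_0 not_le not_less_zero)

text \<open>As long as \<open>p + i\<close> stays inside the list, the iterate of \<open>x\<close>
  at time \<open>i\<close> only changes the first \<open>n\<close> letters, to the path at
  \<open>p + i\<close>, whose first letter is the entry of the block.\<close>

lemma phi_at_position:
  assumes "1 \<le> n" "at_position x n k p" "0 \<le> int p + i"
    "int p + i < int (length (block_of_paths n k))"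
  shows "phi x i = block_of_paths n k ! nat (int p + i)"
proof -
  let ?q = "nat (int p + i)"
  have x: "x = paths n k ! p @- sdrop n x"
    using assms(2) by (metis at_position_def stake_sdrop)
  have q: "?q < length (paths n k)"
    using assms by (simp add: block_of_paths_def)
  have "int_iterate pascal_adic i x = paths n k ! ?q @- sdrop n x"
    using assms x int_iterate_paths[of p n k i "sdrop n x"]
    by (simp add: at_position_def block_of_paths_def)
  moreover have "paths n k ! ?q \<noteq> []"
    using assms(1) length_in_paths[OF nth_mem[OF q]] by auto
  ultimately show ?thesis
    using q unfolding phi_def by (simp add: block_of_paths_def hd_conv_nth shift_snth flip: snth.simps(1))
qed

lemma window_phi_at_position:
  assumes "1 \<le> n" "at_position x n k p" "0 \<le> int p + i"
    "int p + i + int m \<le> int (length (block_of_paths n k))"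
  shows "window (phi x) i m = take m (drop (nat (int p + i)) (block_of_paths n k))"
proof (rule nth_equalityI)
  show "length (window (phi x) i m) = length (take m (drop (nat (int p + i)) (block_of_paths n k)))"
    using assms by (simp add: window_def nat_le_iff)
  fix j assume "j < length (window (phi x) i m)"
  then have j: "j < m" by (simp add: window_def)
  then have "phi x (i + int j) = block_of_paths n k ! nat (int p + (i + int j))"
    using assms by (intro phi_at_position) auto
  moreover have "nat (int p + (i + int j)) = nat (int p + i) + j"
    using assms by (simp add: nat_add_distrib flip: add.assoc)
  ultimately show "window (phi x) i m ! j = take m (drop (nat (int p + i)) (block_of_paths n k)) ! j"
    using j assms by (simp add: window_def)
qed

lemma at_position_False:
  assumes "at_position x n k p" "\<not> x !! n"
  shows "at_position x (Suc n) k p"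
  using assms unfolding at_position_def stake_Suc
  by (cases k) (auto simp: nth_append)

text \<open>A further one puts the path into the second half of the next list, hence the shift by
  the length \<open>n choose Suc k\<close> of the first half.\<close>

lemma at_position_True:
  assumes "at_position x n k p" "x !! n"
  shows "at_position x (Suc n) (Suc k) ((n choose Suc k) + p)"
  using assms unfolding at_position_def stake_Suc
  by (auto simp: nth_append length_paths)

text \<open>Neither the room to the left of the position nor the room to its right ever shrinks; the
  counts of ones and zeros are carried along for the positivity arguments in
  \<open>at_position_grow\<close>.\<close>

lemma at_position_mono:
  assumes "at_position x n k p" "n \<le> n'"
  shows "\<exists>k' p'. at_position x n' k' p' \<and> k \<le> k' \<and> n - k \<le> n' - k' \<and> p \<le> p'
    \<and> (n choose k) - p \<le> (n' choose k') - p'"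
  using assms(2)
proof (induction n' rule: dec_induct)
  case base
  then show ?case using assms(1) by blast
next
  case (step n')
  then obtain k' p' where IH: "at_position x n' k' p'" "k \<le> k'" "n - k \<le> n' - k'" "p \<le> p'"
    "(n choose k) - p \<le> (n' choose k') - p'" by blast
  show ?case
  proof (cases "x !! n'")
    case True
    show ?thesis
      by (rule exI[of _ "Suc k'"], rule exI[of _ "(n' choose Suc k') + p'"])
        (use IH True at_position_True[OF IH(1)] in auto)
  next
    case False
    have "(n' choose k') - p' \<le> (Suc n' choose k') - p'" by (cases k') auto
    moreover have "n - k \<le> Suc n' - k'" using IH by linarith
    ultimately show ?thesis
      using IH False at_position_False[OF IH(1)] by (meson le_trans)
  qed
qed

lemma not_eventually_constant:
  assumes "x \<notin> eventually_constant"
  shows "\<exists>i\<ge>n. x !! i = c"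
proof (rule ccontr)
  assume "\<not> ?thesis"
  then have "sset (sdrop n x) \<subseteq> {\<not> c}"
    by (auto simp: sset_range sdrop_snth)
  then have "sset (sdrop n x) = {\<not> c}"
    using shd_sset[of "sdrop n x"] by auto
  then have "sdrop n x = sconst (\<not> c)" by (simp add: sconst_alt)
  then show False using assms unfolding eventually_constant_def by blast
qed

text \<open>A one read after a zero strictly enlarges the room on the left, and a zero read after a
  one strictly enlarges the room on the right. Hence a zero, a later one and a still later zero
  suffice.\<close>

lemma at_position_grow:
  assumes "at_position x n k p" "x \<notin> eventually_constant"
  shows "\<exists>n' k' p'. n \<le> n' \<and> at_position x n' k' p' \<and> p < p'
    \<and> (n choose k) - p < (n' choose k') - p'"
proof -
  obtain a where a: "n \<le> a" "\<not> x !! a"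
    using not_eventually_constant[OF assms(2), of n False] by auto
  obtain k1 p1 where 1: "at_position x a k1 p1" "p \<le> p1" "(n choose k) - p \<le> (a choose k1) - p1"
    using at_position_mono[OF assms(1) a(1)] by blast
  have 2: "at_position x (Suc a) k1 p1" using at_position_False 1 a by blast
  have le2: "(a choose k1) - p1 \<le> (Suc a choose k1) - p1"
    by (cases k1) auto
  have "k1 \<le> a" using 1 at_position_le by blast
  obtain b where b: "Suc a \<le> b" "x !! b"
    using not_eventually_constant[OF assms(2), of "Suc a" True] by auto
  obtain k2 p2 where 3: "at_position x b k2 p2" "p1 \<le> p2" "Suc a - k1 \<le> b - k2"
      "(Suc a choose k1) - p1 \<le> (b choose k2) - p2"
    using at_position_mono[OF 2 b(1)] by blast
  \<comment> \<open>The zero at index \<open>a\<close> keeps \<open>k2\<close> below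
    \<open>b\<close>, so the left shift \<open>b choose Suc k2\<close> is positive.\<close>
  have k2: "Suc k2 \<le> b" using 3 \<open>k1 \<le> a\<close> by linarith
  have 4: "at_position x (Suc b) (Suc k2) ((b choose Suc k2) + p2)"
    using at_position_True 3 b by blast
  have pos4: "(b choose Suc k2) > 0" using k2 by simp
  obtain c where c: "Suc b \<le> c" "\<not> x !! c"
    using not_eventually_constant[OF assms(2), of "Suc b" False] by auto
  obtain k3 p3 where 5: "at_position x c k3 p3" "(b choose Suc k2) + p2 \<le> p3" "Suc k2 \<le> k3"
      "(Suc b choose Suc k2) - ((b choose Suc k2) + p2) \<le> (c choose k3) - p3"
    using at_position_mono[OF 4 c(1)] by blast
  have 6: "at_position x (Suc c) k3 p3" using at_position_False 5 c by blast
  \<comment> \<open>The one at index \<open>b\<close> makes \<open>k3\<close> positive; the zero at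
    index \<open>c\<close> then adds \<open>c choose k4 > 0\<close> entries on the right.\<close>
  obtain k4 where k4: "k3 = Suc k4" using 5(3) by (cases k3) auto
  have "k3 \<le> c" using 5 at_position_le by blast
  then have "(c choose k4) > 0" using k4 by simp
  moreover have "p3 < (c choose k3)" using 5(1) by (simp add: at_position_def length_paths)
  moreover have "(Suc c choose k3) = (c choose k4) + (c choose k3)" using k4 by simp
  ultimately have "(c choose k3) - p3 < (Suc c choose k3) - p3" by linarith
  moreover have "(Suc b choose Suc k2) - ((b choose Suc k2) + p2) = (b choose k2) - p2" by simp
  ultimately have "(n choose k) - p < (Suc c choose k3) - p3"
    using 1(3) le2 3(4) 5(4) by linarith
  moreover have "p < p3" using 1(2) 3(2) 5(2) pos4 by linarith
  moreover have "n \<le> Suc c" using a(1) b(1) c(1) by linarith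
  ultimately show ?thesis using 6 by blast
qed

text \<open>Iterating \<open>at_position_grow\<close> gives any margin \<open>M\<close> on both
  sides, so every finite window of the coded sequence lies inside a single block.\<close>

lemma at_position_interior:
  assumes "x \<notin> eventually_constant"
  shows "\<exists>n k p. 1 \<le> n \<and> at_position x n k p \<and> M \<le> p \<and> p + M \<le> length (block_of_paths n k)"
proof -
  have "\<exists>n k p. 1 \<le> n \<and> at_position x n k p \<and> M \<le> p \<and> M \<le> (n choose k) - p"
  proof (induction M)
    case 0
    then show ?case using at_position_exists[of x 1] by auto
  next
    case (Suc M)
    then obtain n k p where n: "1 \<le> n" "at_position x n k p" "M \<le> p" "M \<le> (n choose k) - p"
      by blast
    obtain n' k' p' where "n \<le> n'" "at_position x n' k' p'" "p < p'"
        "(n choose k) - p < (n' choose k') - p'"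
      using at_position_grow[OF n(2) assms] by blast
    moreover from this have "1 \<le> n'" "Suc M \<le> p'" "Suc M \<le> (n' choose k') - p'"
      using n by linarith+
    ultimately show ?case by blast
  qed
  then obtain n k p where *: "1 \<le> n" "at_position x n k p" "M \<le> p" "M \<le> (n choose k) - p"
    by blast
  then have "p + M \<le> length (block_of_paths n k)"
    by (auto simp: at_position_def length_paths length_block_of_paths)
  then show ?thesis using * by blast
qed

lemma phi_in_Sigma_shift:
  assumes "x \<notin> eventually_constant"
  shows "phi x \<in> Sigma_shift"
  unfolding Sigma_shift_def
proof safe
  fix i :: int and m :: nat
  assume m: "1 \<le> m"
  \<comment> \<open>The margin \<open>nat \<bar>i\<bar> + m\<close> accommodates a window of length
    \<open>m\<close> starting at time \<open>i\<close>, for either sign of \<open>i\<close>.\<close>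
  obtain n k p where n: "1 \<le> n" "at_position x n k p" "nat \<bar>i\<bar> + m \<le> p"
      "p + (nat \<bar>i\<bar> + m) \<le> length (block_of_paths n k)"
    using at_position_interior[OF assms] by blast
  let ?C = "block_of_paths n k"
  have w: "window (phi x) i m = take m (drop (nat (int p + i)) ?C)"
    using n by (intro window_phi_at_position) auto
  then have "sublist (window (phi x) i m) (block n k)"
    using n by (metis at_position_le block_eq sublist_drop sublist_order.order.trans sublist_take)
  moreover have "window (phi x) i m \<noteq> []" using m by (simp add: window_def)
  ultimately show "window (phi x) i m \<in> lang"
    unfolding lang_def using n at_position_le by blast
qed

section \<open>Counting occurrences in blocks\<close>

definition occurrences :: "'c list \<Rightarrow> 'c list \<Rightarrow> nat set" where
  "occurrences B C = {i. i + length B \<le> length C \<and> take (length B) (drop i C) = B}"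

text \<open>These are the starts from which \<open>B\<close> can be read after a suitable
  continuation of \<open>C\<close> to the right. Their number is subadditive under concatenation,
  whereas full occurrences are superadditive.\<close>

definition partial_occurrences :: "'c list \<Rightarrow> 'c list \<Rightarrow> nat set" where
  "partial_occurrences B C = {i. i < length C \<and> prefix (take (length B) (drop i C)) B}"

lemma freq_eq: "freq B C = real (card (occurrences B C)) / real (length C)"
  by (simp add: freq_def occurrences_def)

lemma finite_occurrences [simp]: "finite (occurrences B C)"
  by (rule finite_subset[of _ "{..length C}"]) (auto simp: occurrences_def)

lemma finite_partial_occurrences [simp]: "finite (partial_occurrences B C)"
  by (rule finite_subset[of _ "{..length C}"]) (auto simp: partial_occurrences_def)

lemma occurrences_subset_partial: "B \<noteq> [] \<Longrightarrow> occurrences B C \<subseteq> partial_occurrences B C"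
  by (cases B) (auto simp: occurrences_def partial_occurrences_def)

lemma card_occurrences_append:
  assumes "B \<noteq> []"
  shows "card (occurrences B C) + card (occurrences B D) \<le> card (occurrences B (C @ D))"
proof -
  \<comment> \<open>Since \<open>B\<close> is nonempty, starts in \<open>C\<close> lie below
    \<open>length C\<close> and are disjoint from the shifted starts in \<open>D\<close>.\<close>
  have lt: "i < length C" if "i \<in> occurrences B C" for i
    using that assms by (cases B) (auto simp: occurrences_def)
  have "card (occurrences B C) + card (occurrences B D)
      = card (occurrences B C \<union> (+) (length C) ` occurrences B D)"
    using lt by (subst card_Un_disjoint) (fastforce simp: card_image)+
  also have "\<dots> \<le> card (occurrences B (C @ D))"
    by (intro card_mono[OF finite_occurrences]) (auto simp: occurrences_def)
  finally show ?thesis .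
qed

lemma card_partial_occurrences_append:
  "card (partial_occurrences B (C @ D))
    \<le> card (partial_occurrences B C) + card (partial_occurrences B D)"
proof -
  have "partial_occurrences B (C @ D)
      \<subseteq> partial_occurrences B C \<union> (+) (length C) ` partial_occurrences B D"
  proof
    fix i assume i: "i \<in> partial_occurrences B (C @ D)"
    show "i \<in> partial_occurrences B C \<union> (+) (length C) ` partial_occurrences B D"
    proof (cases "i < length C")
      case True
      \<comment> \<open>Cutting off \<open>D\<close> leaves fewer letters to compare, so the
        condition only becomes weaker.\<close>
      have "prefix (take (length B) (drop i C)) (take (length B) (drop i (C @ D)))"
        by (simp add: take_append)
      then have "prefix (take (length B) (drop i C)) B"
        using i unfolding partial_occurrences_def by (blast intro: prefix_order.trans)
      then show ?thesis using True by (simp add: partial_occurrences_def)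
    next
      case False
      then have "i = length C + (i - length C)" "i - length C \<in> partial_occurrences B D"
        using i by (auto simp: partial_occurrences_def)
      then show ?thesis by blast
    qed
  qed
  then have "card (partial_occurrences B (C @ D))
      \<le> card (partial_occurrences B C \<union> (+) (length C) ` partial_occurrences B D)"
    by (intro card_mono) auto
  also have "\<dots> \<le> card (partial_occurrences B C) + card (partial_occurrences B D)"
    using card_Un_le card_image_le[OF finite_partial_occurrences]
    by (metis (no_types, lifting) add_left_mono le_trans)
  finally show ?thesis .
qed

text \<open>A partial occurrence that is not a full one must start among the last
  \<open>length B\<close> positions.\<close>

lemma card_partial_occurrences_le:
  assumes "B \<noteq> []"
  shows "card (partial_occurrences B C) \<le> card (occurrences B C) + length B"
proof -
  have "partial_occurrences B C \<subseteq> occurrences B C \<union> {length C - length B..<length C}"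
  proof
    fix i assume i: "i \<in> partial_occurrences B C"
    then obtain zs where zs: "B = take (length B) (drop i C) @ zs"
      by (auto simp: partial_occurrences_def prefix_def)
    show "i \<in> occurrences B C \<union> {length C - length B..<length C}"
    proof (cases "i + length B \<le> length C")
      case True
      then have "zs = []" using arg_cong[OF zs, of length] by simp
      then show ?thesis using zs True by (simp add: occurrences_def)
    qed (use i in \<open>auto simp: partial_occurrences_def\<close>)
  qed
  then have "card (partial_occurrences B C)
      \<le> card (occurrences B C \<union> {length C - length B..<length C})"
    by (intro card_mono) auto
  also have "\<dots> \<le> card (occurrences B C) + card {length C - length B..<length C}"
    by (rule card_Un_le)
  finally show ?thesis by simp
qed

text \<open>The number of copies of \<open>block n j\<close> in the decomposition of
  \<open>block (n + d) k\<close>; it does not depend on \<open>n\<close>.\<close>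

definition multiplicity_in_block :: "nat \<Rightarrow> nat \<Rightarrow> nat \<Rightarrow> nat" where
  "multiplicity_in_block d k j = (if j \<le> k then d choose (k - j) else 0)"

section \<open>Splitting a block into blocks of a lower row\<close>

lemma multiplicity_in_block_0: "multiplicity_in_block 0 k j = (if j = k then 1 else 0)"
  by (auto simp: multiplicity_in_block_def)

lemma multiplicity_in_block_Suc_0:
  "multiplicity_in_block (Suc d) 0 j = multiplicity_in_block d 0 j"
  by (auto simp: multiplicity_in_block_def)

text \<open>Pascal's rule. For \<open>j = Suc k\<close> the guard \<open>j \<le> k\<close> removes
  the last summand, which truncated subtraction would otherwise turn into 1.\<close>

lemma multiplicity_in_block_Suc_Suc:
  "multiplicity_in_block (Suc d) (Suc k) j
    = multiplicity_in_block d (Suc k) j + multiplicity_in_block d k j"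
  by (auto simp: multiplicity_in_block_def Suc_diff_le le_Suc_eq)

text \<open>Induction on the number \<open>d\<close> of rows descended: the last concatenation
  splits the block, and the multiplicities of the two factors add up by Pascal's rule.\<close>

lemma superadditive_block_of_paths:
  fixes g :: "letter list \<Rightarrow> nat"
  assumes g: "\<And>C D. g C + g D \<le> g (C @ D)" and n: "1 \<le> n"
  shows "(\<Sum>j\<le>n. multiplicity_in_block d k j * g (block_of_paths n j))
    \<le> g (block_of_paths (n + d) k)"
proof (induction d arbitrary: k)
  case 0
  show ?case by (simp add: multiplicity_in_block_0 sum.delta if_distrib[of "\<lambda>x. x * _"] cong: if_cong)
next
  case (Suc d)
  have "1 \<le> n + d" using n by simp
  note rec = block_of_paths_0[OF this] block_of_paths_Suc[OF this]
  show ?case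
  proof (cases k)
    case 0
    then show ?thesis
      using Suc[of 0] by (simp add: multiplicity_in_block_Suc_0 rec)
  next
    case (Suc k')
    then show ?thesis
      using add_mono[OF Suc.IH[of "Suc k'"] Suc.IH[of k']]
        g[of "block_of_paths (n + d) (Suc k')" "block_of_paths (n + d) k'"]
      by (simp add: multiplicity_in_block_Suc_Suc rec add_mult_distrib sum.distrib)
  qed
qed

lemma subadditive_block_of_paths:
  fixes g :: "letter list \<Rightarrow> nat"
  assumes g: "\<And>C D. g (C @ D) \<le> g C + g D" and g0: "g [] = 0" and n: "1 \<le> n"
  shows "g (block_of_paths (n + d) k)
    \<le> (\<Sum>j\<le>n. multiplicity_in_block d k j * g (block_of_paths n j))"
proof (induction d arbitrary: k)
  case 0
  \<comment> \<open>For \<open>k > n\<close> the sum has no term with \<open>j = k\<close>, while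
    the block is empty; \<open>g0\<close> closes this case.\<close>
  show ?case
    by (simp add: multiplicity_in_block_0 sum.delta if_distrib[of "\<lambda>x. x * _"]
        block_of_paths_eq_Nil g0 cong: if_cong)
next
  case (Suc d)
  have "1 \<le> n + d" using n by simp
  note rec = block_of_paths_0[OF this] block_of_paths_Suc[OF this]
  show ?case
  proof (cases k)
    case 0
    then show ?thesis
      using Suc[of 0] by (simp add: multiplicity_in_block_Suc_0 rec)
  next
    case (Suc k')
    then show ?thesis
      using add_mono[OF Suc.IH[of "Suc k'"] Suc.IH[of k']]
        g[of "block_of_paths (n + d) (Suc k')" "block_of_paths (n + d) k'"]
      by (simp add: multiplicity_in_block_Suc_Suc rec add_mult_distrib sum.distrib)
  qed
qed

section \<open>Asymptotics of binomial ratios\<close>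

text \<open>Induction on \<open>n\<close>, removing one row at a time:
  \<open>(g-1 choose f) / (g choose f) = 1 - f/g\<close> and
  \<open>(g-1 choose f-1) / (g choose f) = f/g\<close>. Keeping \<open>f\<close> and
  \<open>g\<close> general lets the induction hypothesis apply to \<open>g - 1\<close> with
  \<open>f\<close> or \<open>f - 1\<close>.\<close>

lemma binomial_shift_ratio_tendsto:
  fixes f g :: "nat \<Rightarrow> nat"
  assumes "filterlim g at_top sequentially" "(\<lambda>i. real (f i) / real (g i)) \<longlonglongrightarrow> \<alpha>"
    "0 < \<alpha>" "\<alpha> < 1" "j \<le> n"
  shows "(\<lambda>i. real ((g i - n) choose (f i - j)) / real (g i choose f i))
    \<longlonglongrightarrow> \<alpha> ^ j * (1 - \<alpha>) ^ (n - j)"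
  using assms(1,2,5)
proof (induction n arbitrary: j f g)
  case 0
  have "\<forall>\<^sub>F i in sequentially. real (f i) / real (g i) < 1"
    using order_tendstoD(2)[OF 0(2) assms(4)] .
  \<comment> \<open>Eventually \<open>f i < g i\<close>, so numerator and denominator are the same
    nonzero binomial coefficient.\<close>
  then have "\<forall>\<^sub>F i in sequentially. 1 = real ((g i - 0) choose (f i - j)) / real (g i choose f i)"
    using filterlim_at_top[THEN iffD1, OF 0(1), rule_format, of 1]
    by eventually_elim (use 0 in \<open>auto simp: divide_simps\<close>)
  from Lim_transform_eventually[OF tendsto_const this] 0 show ?case by simp
next
  case (Suc n)
  have g: "\<forall>\<^sub>F i in sequentially. g i > 1"
    using filterlim_at_top[THEN iffD1, OF Suc.prems(1), rule_format, of 2] by eventually_elim simp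
  have "\<forall>\<^sub>F i in sequentially. real (f i) / real (g i) < 1 \<and> real (f i) / real (g i) > 0"
    using order_tendstoD(2)[OF Suc.prems(2) assms(4)] order_tendstoD(1)[OF Suc.prems(2) assms(3)]
    by eventually_elim auto
  then have fg: "\<forall>\<^sub>F i in sequentially. 0 < f i \<and> f i < g i \<and> g i > 1"
    using g by eventually_elim (auto simp: zero_less_divide_iff)
  have g': "filterlim (\<lambda>i. g i - 1) at_top sequentially"
    using filterlim_minus_const_nat_at_top[of 1] Suc.prems(1) filterlim_compose by blast
  have inv: "(\<lambda>i. 1 / real (g i)) \<longlonglongrightarrow> 0"
    by (intro tendsto_divide_0[OF tendsto_const] filterlim_at_top_imp_at_infinity
        filterlim_compose[OF filterlim_real_sequentially Suc.prems(1)])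
  \<comment> \<open>This quotient is \<open>f / (g - 1)\<close>, which shows that lowering the row
    by one keeps the limit \<open>\<alpha>\<close>.\<close>
  have r0: "(\<lambda>i. real (f i) / real (g i) / (1 - 1 / real (g i))) \<longlonglongrightarrow> \<alpha> / (1 - 0)"
    by (intro tendsto_intros Suc.prems(2) inv) auto
  show ?case
  proof (cases j)
    case 0
    have "\<forall>\<^sub>F i in sequentially.
        real (f i) / real (g i) / (1 - 1 / real (g i)) = real (f i) / real (g i - 1)"
      using fg by eventually_elim (simp add: of_nat_diff field_simps)
    from Lim_transform_eventually[OF r0 this]
    have "(\<lambda>i. real (f i) / real (g i - 1)) \<longlonglongrightarrow> \<alpha>" by simp
    then have IH: "(\<lambda>i. real ((g i - 1 - n) choose f i) / real (g i - 1 choose f i))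
        \<longlonglongrightarrow> (1 - \<alpha>) ^ n"
      using Suc.IH[OF g', of f 0] by simp
    have "(\<lambda>i. (1 - real (f i) / real (g i)) *
        (real ((g i - 1 - n) choose f i) / real (g i - 1 choose f i))) \<longlonglongrightarrow> (1 - \<alpha>) * (1 - \<alpha>) ^ n"
      by (intro tendsto_intros Suc.prems(2) IH)
    moreover have "\<forall>\<^sub>F i in sequentially. (1 - real (f i) / real (g i)) *
        (real ((g i - 1 - n) choose f i) / real (g i - 1 choose f i))
        = real ((g i - Suc n) choose (f i - j)) / real (g i choose f i)"
      using fg
    proof eventually_elim
      case (elim i)
      have "(g i - f i) * (g i choose f i) = g i * ((g i - 1) choose f i)"
        using binomial_absorb_comp[of "g i" "f i"] by simp
      then have "(real (g i) - real (f i)) * real (g i choose f i) = real (g i) * real ((g i - 1) choose f i)"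
        using elim by (metis of_nat_diff of_nat_mult less_imp_le)
      moreover have pos: "real (g i choose f i) > 0" "real ((g i - 1) choose f i) > 0"
        using elim by auto
      ultimately have "1 - real (f i) / real (g i) = real ((g i - 1) choose f i) / real (g i choose f i)"
        using elim by (simp add: field_simps)
      then show ?case using pos 0 by simp
    qed
    ultimately show ?thesis using 0 by (simp add: Lim_transform_eventually)
  next
    case (Suc j')
    \<comment> \<open>The same rescaling for \<open>(f - 1) / (g - 1)\<close>; the subtracted term
      tends to 0.\<close>
    have "(\<lambda>i. real (f i) / real (g i) / (1 - 1 / real (g i)) - 1 / real (g i) / (1 - 1 / real (g i)))
        \<longlonglongrightarrow> \<alpha> / (1 - 0) - 0 / (1 - 0)"
      by (intro tendsto_intros r0 Suc.prems(2) inv) auto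
    moreover have "\<forall>\<^sub>F i in sequentially.
        real (f i) / real (g i) / (1 - 1 / real (g i)) - 1 / real (g i) / (1 - 1 / real (g i))
        = real (f i - 1) / real (g i - 1)"
      using fg
    proof eventually_elim
      case (elim i)
      then have "real (g i) * (1 - 1 / real (g i)) = real (g i - 1)"
        by (simp add: of_nat_diff field_simps)
      then show ?case
        using elim by (simp only: divide_divide_eq_left flip: diff_divide_distrib) simp
    qed
    ultimately have "(\<lambda>i. real (f i - 1) / real (g i - 1)) \<longlonglongrightarrow> \<alpha> / (1 - 0) - 0 / (1 - 0)"
      by (rule Lim_transform_eventually)
    then have "(\<lambda>i. real (f i - 1) / real (g i - 1)) \<longlonglongrightarrow> \<alpha>" by simp
    note IH = Suc.IH[OF g' this, of j']
    have "(\<lambda>i. real (f i) / real (g i) *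
        (real ((g i - 1 - n) choose (f i - 1 - j')) / real (g i - 1 choose (f i - 1))))
        \<longlonglongrightarrow> \<alpha> * (\<alpha> ^ j' * (1 - \<alpha>) ^ (n - j'))"
      using Suc Suc.prems by (intro tendsto_intros IH) auto
    moreover have "\<forall>\<^sub>F i in sequentially. real (f i) / real (g i) *
        (real ((g i - 1 - n) choose (f i - 1 - j')) / real (g i - 1 choose (f i - 1)))
        = real ((g i - Suc n) choose (f i - j)) / real (g i choose f i)"
      using fg
    proof eventually_elim
      case (elim i)
      have "f i * (g i choose f i) = g i * ((g i - 1) choose (f i - 1))"
        using times_binomial_minus1_eq[of "f i" "g i"] elim by simp
      then have "real (f i) * real (g i choose f i) = real (g i) * real ((g i - 1) choose (f i - 1))"
        by (metis of_nat_mult)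
      moreover have pos: "real (g i choose f i) > 0" "real ((g i - 1) choose (f i - 1)) > 0"
        using elim by auto
      ultimately have "real (f i) / real (g i)
          = real ((g i - 1) choose (f i - 1)) / real (g i choose f i)"
        using elim by (simp add: field_simps)
      then show ?case using pos Suc by simp
    qed
    ultimately show ?thesis using Suc by (simp add: Lim_transform_eventually mult.assoc)
  qed
qed

lemma multiplicity_ratio_tendsto:
  fixes k :: "nat \<Rightarrow> nat"
  assumes "filterlim k at_top sequentially" "(\<lambda>n. real (k n) / real n) \<longlonglongrightarrow> \<alpha>"
    "0 < \<alpha>" "\<alpha> < 1" "j \<le> N"
  shows "(\<lambda>n. real (multiplicity_in_block (n - N) (k n) j) / real (n choose k n))
    \<longlonglongrightarrow> \<alpha> ^ j * (1 - \<alpha>) ^ (N - j)"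
proof (rule Lim_transform_eventually)
  show "(\<lambda>n. real ((n - N) choose (k n - j)) / real (n choose k n)) \<longlonglongrightarrow> \<alpha> ^ j * (1 - \<alpha>) ^ (N - j)"
    using assms by (intro binomial_shift_ratio_tendsto filterlim_ident)
  \<comment> \<open>Divergence of \<open>k\<close> makes the guard in
    \<open>multiplicity_in_block\<close> eventually true.\<close>
  have "\<forall>\<^sub>F n in sequentially. j \<le> k n"
    using assms(1) by (simp add: filterlim_at_top)
  then show "\<forall>\<^sub>F n in sequentially. real ((n - N) choose (k n - j)) / real (n choose k n)
      = real (multiplicity_in_block (n - N) (k n) j) / real (n choose k n)"
    by eventually_elim (simp add: multiplicity_in_block_def)
qed

section \<open>Weighted counts and convergence of the frequencies\<close>

text \<open>For \<open>0 < \<alpha> < 1\<close> and \<open>k \<le> n\<close> this is the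
  \<open>mu\<close>-measure of one cylinder of length \<open>n\<close> with \<open>k\<close> ones,
  see \<open>measure_mu_cylinder\<close>.\<close>

definition path_weight :: "real \<Rightarrow> nat \<Rightarrow> nat \<Rightarrow> real" where
  "path_weight \<alpha> n k = \<alpha> ^ k * (1 - \<alpha>) ^ (n - k)"

text \<open>Without binomial factors the sum is not the total mass: it has \<open>n + 1\<close>
  terms, each at most \<open>c ^ n\<close> with
  \<open>c = max \<alpha> (1 - \<alpha>) < 1\<close>.\<close>

lemma sum_path_weight_tendsto_0:
  assumes "0 < \<alpha>" "\<alpha> < 1"
  shows "(\<lambda>n. \<Sum>j\<le>n. path_weight \<alpha> n j) \<longlonglongrightarrow> 0"
proof (rule tendsto_sandwich[OF _ _ tendsto_const])
  define c where "c = max \<alpha> (1 - \<alpha>)"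
  have c: "0 < c" "c < 1" using assms by (auto simp: c_def)
  have le: "path_weight \<alpha> n j \<le> c ^ n" if "j \<le> n" for n j
  proof -
    have "path_weight \<alpha> n j \<le> c ^ j * c ^ (n - j)"
      unfolding path_weight_def c_def using assms by (intro mult_mono power_mono) auto
    then show ?thesis using that by (simp flip: power_add)
  qed
  have "(\<Sum>j\<le>n. path_weight \<alpha> n j) \<le> real (Suc n) * c ^ n" for n
    using sum_bounded_above[of "{..n}" "path_weight \<alpha> n" "c ^ n"] le by auto
  then show "\<forall>\<^sub>F n in sequentially. (\<Sum>j\<le>n. path_weight \<alpha> n j) \<le> real (Suc n) * c ^ n" by simp
  show "\<forall>\<^sub>F n in sequentially. 0 \<le> (\<Sum>j\<le>n. path_weight \<alpha> n j)"
    using assms by (auto simp: path_weight_def intro!: sum_nonneg always_eventually)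
  have "(\<lambda>n. real n * c ^ n + c ^ n) \<longlonglongrightarrow> 0 + 0"
    using c by (intro tendsto_add powser_times_n_limit_0 LIMSEQ_realpow_zero) auto
  then show "(\<lambda>n. real (Suc n) * c ^ n) \<longlonglongrightarrow> 0" by (simp add: algebra_simps)
qed

definition lower_freq :: "real \<Rightarrow> letter list \<Rightarrow> nat \<Rightarrow> real" where
  "lower_freq \<alpha> B n = (\<Sum>j\<le>n. path_weight \<alpha> n j * card (occurrences B (block_of_paths n j)))"

definition upper_freq :: "real \<Rightarrow> letter list \<Rightarrow> nat \<Rightarrow> real" where
  "upper_freq \<alpha> B n = (\<Sum>j\<le>n. path_weight \<alpha> n j * card (partial_occurrences B (block_of_paths n j)))"

lemma upper_freq_minus_lower_freq_tendsto_0: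
  assumes "0 < \<alpha>" "\<alpha> < 1" "B \<noteq> []"
  shows "(\<lambda>n. upper_freq \<alpha> B n - lower_freq \<alpha> B n) \<longlonglongrightarrow> 0"
proof (rule tendsto_sandwich[OF _ _ tendsto_const])
  have w: "0 \<le> path_weight \<alpha> n j" for n j using assms by (simp add: path_weight_def)
  show "\<forall>\<^sub>F n in sequentially. 0 \<le> upper_freq \<alpha> B n - lower_freq \<alpha> B n"
    using w card_mono[OF finite_partial_occurrences occurrences_subset_partial[OF assms(3)]]
    by (auto simp: upper_freq_def lower_freq_def intro!: always_eventually sum_mono mult_left_mono)
  have "upper_freq \<alpha> B n \<le> (\<Sum>j\<le>n. path_weight \<alpha> n j * (card (occurrences B (block_of_paths n j)) + length B))" for n
    unfolding upper_freq_def using w card_partial_occurrences_le[OF assms(3)]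
    by (intro sum_mono mult_left_mono) (auto simp flip: of_nat_add)
  then show "\<forall>\<^sub>F n in sequentially. upper_freq \<alpha> B n - lower_freq \<alpha> B n \<le> (\<Sum>j\<le>n. path_weight \<alpha> n j) * length B"
    by (simp add: lower_freq_def distrib_left sum.distrib sum_distrib_right diff_le_eq add.commute)
  show "(\<lambda>n. (\<Sum>j\<le>n. path_weight \<alpha> n j) * length B) \<longlonglongrightarrow> 0"
    using tendsto_mult_right[OF sum_path_weight_tendsto_0[OF assms(1,2)], of "real (length B)"] by simp
qed

lemma freq_block_bounds:
  fixes B :: "letter list"
  assumes "B \<noteq> []" "1 \<le> N" "N \<le> n" "k \<le> n"
  shows "(\<Sum>j\<le>N. multiplicity_in_block (n - N) k j / (n choose k) * card (occurrences B (block_of_paths N j)))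
      \<le> freq B (block n k)"
    and "freq B (block n k)
      \<le> (\<Sum>j\<le>N. multiplicity_in_block (n - N) k j / (n choose k) * card (partial_occurrences B (block_of_paths N j)))"
proof -
  have n: "1 \<le> n" using assms by simp
  have eq: "freq B (block n k) = card (occurrences B (block_of_paths n k)) / (n choose k)"
    using n assms by (simp add: freq_eq block_eq length_block_of_paths)
  have "(\<Sum>j\<le>N. multiplicity_in_block (n - N) k j * card (occurrences B (block_of_paths N j)))
      \<le> card (occurrences B (block_of_paths n k))"
    using superadditive_block_of_paths[of "\<lambda>C. card (occurrences B C)" N "n - N" k]
      card_occurrences_append[OF assms(1)] assms by simp
  then have "real (\<Sum>j\<le>N. multiplicity_in_block (n - N) k j * card (occurrences B (block_of_paths N j))) / (n choose k)
      \<le> card (occurrences B (block_of_paths n k)) / (n choose k)"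
    by (intro divide_right_mono) (simp_all only: of_nat_le_iff of_nat_0_le_iff)
  then show "(\<Sum>j\<le>N. multiplicity_in_block (n - N) k j / (n choose k) * card (occurrences B (block_of_paths N j)))
      \<le> freq B (block n k)"
    by (simp add: eq sum_divide_distrib)
  \<comment> \<open>Full occurrences need not be subadditive, so the upper bound first passes to
    partial ones.\<close>
  have "card (occurrences B (block_of_paths n k)) \<le> card (partial_occurrences B (block_of_paths n k))"
    by (intro card_mono occurrences_subset_partial assms finite_partial_occurrences)
  also have "\<dots> \<le> (\<Sum>j\<le>N. multiplicity_in_block (n - N) k j * card (partial_occurrences B (block_of_paths N j)))"
    using subadditive_block_of_paths[of "\<lambda>C. card (partial_occurrences B C)" N "n - N" k]
      card_partial_occurrences_append[of B] assms by (simp add: partial_occurrences_def)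
  finally have "card (occurrences B (block_of_paths n k)) / (n choose k)
    \<le> real (\<Sum>j\<le>N. multiplicity_in_block (n - N) k j * card (partial_occurrences B (block_of_paths N j))) / (n choose k)"
    by (intro divide_right_mono) (simp_all only: of_nat_le_iff of_nat_0_le_iff)
  then show "freq B (block n k)
      \<le> (\<Sum>j\<le>N. multiplicity_in_block (n - N) k j / (n choose k) * card (partial_occurrences B (block_of_paths N j)))"
    by (simp add: eq sum_divide_distrib)
qed

text \<open>Leaving \<open>L\<close> abstract separates the counting from the measure theory. A
  fixed row \<open>N\<close> with gap below \<open>e / 2\<close> is chosen first; for large
  \<open>n\<close> the convergence of the weights costs at most another
  \<open>e / 2\<close>.\<close>

lemma freq_block_tendsto:
  fixes B :: "letter list" and L :: real
  assumes "0 < \<alpha>" "\<alpha> < 1" "B \<noteq> []"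
    and k: "\<And>n. 1 \<le> n \<Longrightarrow> k n \<le> n" "filterlim k at_top sequentially"
      "(\<lambda>n. real (k n) / real n) \<longlonglongrightarrow> \<alpha>"
    and L: "\<And>N. 1 \<le> N \<Longrightarrow> lower_freq \<alpha> B N \<le> L" "\<And>N. 1 \<le> N \<Longrightarrow> L \<le> upper_freq \<alpha> B N"
  shows "(\<lambda>n. freq B (block n (k n))) \<longlonglongrightarrow> L"
proof (rule tendstoI)
  fix e :: real assume e: "0 < e"
  have "\<forall>\<^sub>F N in sequentially. upper_freq \<alpha> B N - lower_freq \<alpha> B N < e / 2 \<and> 1 \<le> N"
    using order_tendstoD(2)[OF upper_freq_minus_lower_freq_tendsto_0[OF assms(1-3)], of "e / 2"] e
      eventually_ge_at_top[of "1::nat"] by (auto intro: eventually_conj)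
  then obtain N where N: "upper_freq \<alpha> B N - lower_freq \<alpha> B N < e / 2" "1 \<le> N"
    by (auto dest: eventually_happens)
  have lim: "(\<lambda>n. \<Sum>j\<le>N. multiplicity_in_block (n - N) (k n) j / (n choose k n) * c j)
      \<longlonglongrightarrow> (\<Sum>j\<le>N. path_weight \<alpha> N j * c j)" for c :: "nat \<Rightarrow> real"
    unfolding path_weight_def
    by (intro tendsto_sum tendsto_mult tendsto_const multiplicity_ratio_tendsto k assms) auto
  have lo: "\<forall>\<^sub>F n in sequentially. lower_freq \<alpha> B N - e / 2
      < (\<Sum>j\<le>N. multiplicity_in_block (n - N) (k n) j / (n choose k n) * card (occurrences B (block_of_paths N j)))"
    using order_tendstoD(1)[OF lim] e by (simp add: lower_freq_def)
  have hi: "\<forall>\<^sub>F n in sequentially.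
      (\<Sum>j\<le>N. multiplicity_in_block (n - N) (k n) j / (n choose k n) * card (partial_occurrences B (block_of_paths N j)))
      < upper_freq \<alpha> B N + e / 2"
    using order_tendstoD(2)[OF lim] e by (simp add: upper_freq_def)
  show "\<forall>\<^sub>F n in sequentially. dist (freq B (block n (k n))) L < e"
    using lo hi eventually_ge_at_top[of N]
  proof eventually_elim
    case (elim n)
    then have "k n \<le> n" using k(1) N by simp
    from freq_block_bounds[OF assms(3) N(2) elim(3) this] elim N L[OF N(2)]
    show ?case unfolding dist_real_def by linarith
  qed
qed

section \<open>Cylinders and the measure of a word\<close>

lemma space_mu [simp]: "space (mu \<alpha>) = UNIV"
  by (simp add: mu_def space_stream_space)

lemma sets_mu [measurable_cong]: "sets (mu \<alpha>) = sets (stream_space (count_space UNIV))"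
  unfolding mu_def by (rule sets_stream_space_cong) simp

lemma prob_space_mu: "prob_space (mu \<alpha>)"
  unfolding mu_def
  by (rule prob_space.prob_space_stream_space) (rule prob_space_measure_pmf)

lemma sets_mu_stake [measurable]: "{x. stake n x \<in> W} \<in> sets (mu \<alpha>)"
proof -
  have "stake n -` W \<inter> space (mu \<alpha>) \<in> sets (mu \<alpha>)"
    by (rule measurable_sets[of _ _ "count_space UNIV"]) measurable
  then show ?thesis by (simp add: vimage_def)
qed

text \<open>Induction on the word: the product structure splits off the first coordinate, which
  contributes the factor \<open>pmf (bernoulli_pmf \<alpha>) b\<close>.\<close>

lemma measure_mu_cylinder:
  assumes "0 < \<alpha>" "\<alpha> < 1"
  shows "measure (mu \<alpha>) {x. stake (length w) x = w}
    = path_weight \<alpha> (length w) (count_list w True)"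
proof (induction w)
  case Nil
  show ?case
    using prob_space.prob_space[OF prob_space_mu, of \<alpha>] by (simp add: path_weight_def)
next
  case (Cons b w)
  interpret prob_space "mu \<alpha>" by (rule prob_space_mu)
  let ?p = "measure_pmf (bernoulli_pmf \<alpha>)"
  have meas: "{x. stake (length w) x = w} \<in> sets (mu \<alpha>)" for w
    using sets_mu_stake[of "length w" "{w}" \<alpha>] by simp
  have "emeasure (mu \<alpha>) {x. stake (length (b # w)) x = b # w}
      = (\<integral>\<^sup>+t. emeasure (mu \<alpha>) {x. stake (length (b # w)) (t ## x) = b # w} \<partial>?p)"
    using prob_space.emeasure_stream_space[OF prob_space_measure_pmf[of "bernoulli_pmf \<alpha>"],
        of "{x. stake (length (b # w)) x = b # w}"] meas[of "b # w"]
    by (simp add: mu_def space_stream_space)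
  also have "\<dots> = (\<integral>\<^sup>+t. emeasure (mu \<alpha>) {x. stake (length w) x = w} * indicator {b} t \<partial>?p)"
    by (intro nn_integral_cong) (auto split: split_indicator)
  also have "\<dots> = ennreal (pmf (bernoulli_pmf \<alpha>) b) * emeasure (mu \<alpha>) {x. stake (length w) x = w}"
    by (subst nn_integral_cmult) (auto simp: emeasure_pmf_single mult.commute)
  finally have "measure (mu \<alpha>) {x. stake (length (b # w)) x = b # w}
      = pmf (bernoulli_pmf \<alpha>) b * measure (mu \<alpha>) {x. stake (length w) x = w}"
    by (simp add: emeasure_eq_measure ennreal_mult[symmetric])
  moreover have "count_list w True \<le> length w" by (rule count_le_length)
  ultimately show ?case
    using assms Cons by (cases b) (auto simp: path_weight_def Suc_diff_le)
qed

lemma measure_mu_stake: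
  assumes "0 < \<alpha>" "\<alpha> < 1" "finite W" "\<And>w. w \<in> W \<Longrightarrow> length w = n"
  shows "measure (mu \<alpha>) {x. stake n x \<in> W} = (\<Sum>w\<in>W. path_weight \<alpha> n (count_list w True))"
proof -
  interpret prob_space "mu \<alpha>" by (rule prob_space_mu)
  have "measure (mu \<alpha>) (\<Union>w\<in>W. {x. stake n x \<in> {w}}) = (\<Sum>w\<in>W. measure (mu \<alpha>) {x. stake n x \<in> {w}})"
    using assms(3) sets_mu_stake
    by (intro finite_measure_finite_Union) (blast, blast, auto simp: disjoint_family_on_def)
  moreover have "(\<Union>w\<in>W. {x. stake n x \<in> {w}}) = {x. stake n x \<in> W}" by auto
  moreover have "measure (mu \<alpha>) {x. stake n x \<in> {w}} = path_weight \<alpha> n (count_list w True)" if "w \<in> W" for w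
    using measure_mu_cylinder[OF assms(1,2), of w] assms(4)[OF that] by simp
  ultimately show ?thesis by simp
qed

section \<open>Cylinders selected by positions\<close>

definition indexed_paths :: "nat \<Rightarrow> (nat \<Rightarrow> nat set) \<Rightarrow> bool list set" where
  "indexed_paths n P = {paths n j ! p | j p. p < length (paths n j) \<and> p \<in> P j}"

lemma stake_in_indexed_paths_iff:
  "stake n x \<in> indexed_paths n P \<longleftrightarrow> (\<exists>j p. at_position x n j p \<and> p \<in> P j)"
  by (auto simp: indexed_paths_def at_position_def)

text \<open>Different index pairs give different words, since \<open>j\<close> is the number of ones
  and each path list is distinct. The cylinders are therefore disjoint, and each one at level
  \<open>j\<close> has mass \<open>path_weight \<alpha> n j\<close>.\<close>

lemma measure_indexed_paths:
  assumes "0 < \<alpha>" "\<alpha> < 1" "\<And>j p. p \<in> P j \<Longrightarrow> p < length (paths n j)"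
  shows "measure (mu \<alpha>) {x. stake n x \<in> indexed_paths n P} = (\<Sum>j\<le>n. path_weight \<alpha> n j * card (P j))"
proof -
  have count: "count_list (paths n j ! p) True = j" "length (paths n j ! p) = n"
    if "p < length (paths n j)" for j p
    using nth_mem[OF that] by (auto simp: set_paths)
  have le: "j \<le> n" if "p \<in> P j" for j p
    using assms(3)[OF that] by (metis length_paths binomial_eq_0 not_le not_less_zero)
  have fin: "finite (P j)" for j
    by (rule finite_subset[of _ "{..<length (paths n j)}"]) (use assms(3) in auto)
  let ?S = "SIGMA j:{..n}. P j"
  have eq: "indexed_paths n P = (\<lambda>(j, p). paths n j ! p) ` ?S"
    using assms(3) le by (force simp: indexed_paths_def)
  have inj: "inj_on (\<lambda>(j, p). paths n j ! p) ?S"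
  proof (rule inj_onI; clarify)
    fix j p j' p' assume "paths n j ! p = paths n j' ! p'" "p \<in> P j" "p' \<in> P j'"
    then show "j = j' \<and> p = p'"
      using count(1)[of p j] count(1)[of p' j'] assms(3)
      by (metis distinct_paths nth_eq_iff_index_eq)
  qed
  have "measure (mu \<alpha>) {x. stake n x \<in> indexed_paths n P}
      = (\<Sum>w\<in>indexed_paths n P. path_weight \<alpha> n (count_list w True))"
    using assms count(2) fin by (intro measure_mu_stake) (auto simp: eq)
  also have "\<dots> = (\<Sum>(j, p)\<in>?S. path_weight \<alpha> n j)"
    unfolding eq using inj assms(3) count(1)
    by (subst sum.reindex) (auto intro!: sum.cong)
  also have "\<dots> = (\<Sum>j\<le>n. path_weight \<alpha> n j * card (P j))"
    using fin by (simp flip: sum.Sigma add: mult.commute)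
  finally show ?thesis .
qed

section \<open>The exceptional set and measurability of the coding\<close>

lemma null_sets_eventually_constant:
  assumes "0 < \<alpha>" "\<alpha> < 1"
  shows "eventually_constant \<in> null_sets (mu \<alpha>)"
proof -
  interpret prob_space "mu \<alpha>" by (rule prob_space_mu)
  have single: "{x} \<in> null_sets (mu \<alpha>)" for x
  proof -
    have "{x} = (\<Inter>n. {y. stake n y \<in> {stake n x}})"
    proof (intro equalityI subsetI)
      fix y assume "y \<in> (\<Inter>n. {y. stake n y \<in> {stake n x}})"
      then have "stake n y = stake n x" for n by blast
      then have "y !! n = x !! n" for n by (metis lessI stake_nth)
      then show "y \<in> {x}" using smap_alt[of id y x] by (simp add: stream.map_id)
    qed simp
    also have "\<dots> \<in> sets (mu \<alpha>)" using sets_mu_stake by (intro sets.countable_INT) blast+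
    finally have meas: "{x} \<in> sets (mu \<alpha>)" .
    \<comment> \<open>The cylinder around \<open>x\<close> has a single path weight as its mass;
      bounding it by the whole sum reuses the known limit 0.\<close>
    have "measure (mu \<alpha>) {x} \<le> (\<Sum>j\<le>n. path_weight \<alpha> n j)" for n
    proof -
      have "measure (mu \<alpha>) {x} \<le> measure (mu \<alpha>) {y. stake n y \<in> {stake n x}}"
        by (intro finite_measure_mono sets_mu_stake) simp
      also have "\<dots> = path_weight \<alpha> n (count_list (stake n x) True)"
        using measure_mu_cylinder[OF assms, of "stake n x"] by simp
      also have "\<dots> \<le> (\<Sum>j\<le>n. path_weight \<alpha> n j)"
        using assms count_le_length[of "stake n x" True]
        by (intro member_le_sum) (auto simp: path_weight_def)
      finally show ?thesis .
    qed
    then have "measure (mu \<alpha>) {x} \<le> 0"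
      by (intro LIMSEQ_le_const[OF sum_path_weight_tendsto_0[OF assms]]) auto
    then show ?thesis
      using meas by (simp add: null_sets_def emeasure_eq_measure measure_le_0_iff)
  qed
  have "eventually_constant \<subseteq> (\<lambda>(w, c). w @- sconst c) ` UNIV"
  proof
    fix x assume "x \<in> eventually_constant"
    then obtain n c where "sdrop n x = sconst c" unfolding eventually_constant_def by blast
    then have "x = stake n x @- sconst c" by (metis stake_sdrop)
    then show "x \<in> (\<lambda>(w, c). w @- sconst c) ` UNIV" by (metis (mono_tags) case_prod_conv rangeI)
  qed
  then have "countable eventually_constant"
    by (rule countable_subset) auto
  from null_sets_UN'[OF this, of "\<lambda>x. {x}"] single show ?thesis by simp
qed

lemma sets_not_eventually_constant:
  assumes "0 < \<alpha>" "\<alpha> < 1"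
  shows "- eventually_constant \<in> sets (mu \<alpha>)"
  using sets.compl_sets[OF null_setsD2[OF null_sets_eventually_constant[OF assms]]]
  by (simp add: Compl_eq_Diff_UNIV)

text \<open>Each coordinate has finitely many values, and by \<open>at_position_interior\<close> the
  preimage of a letter is, off the exceptional set, a countable union of cylinder sets.\<close>

lemma measurable_phi:
  assumes "0 < \<alpha>" "\<alpha> < 1"
  shows "phi \<in> measurable (restrict_space (mu \<alpha>) (- eventually_constant)) Sigma_space"
  unfolding Sigma_space_def
proof (rule measurable_restrict_space2)
  let ?M = "restrict_space (mu \<alpha>) (- eventually_constant)"
  show "phi \<in> space ?M \<rightarrow> Sigma_shift"
    using phi_in_Sigma_shift by (auto simp: space_restrict_space)
  have "(\<lambda>x. phi x i) \<in> measurable ?M (count_space UNIV)" for i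
  proof -
    have "(\<lambda>x. phi x i) -` {c} \<inter> space ?M \<in> sets ?M" for c
    proof -
      \<comment> \<open>The positions from which the letter at time \<open>i\<close> is visible
        inside the block and equals \<open>c\<close>.\<close>
      define P where "P n j = {p. 0 \<le> int p + i \<and> int p + i < int (length (block_of_paths n j))
        \<and> block_of_paths n j ! nat (int p + i) = c}" for n j
      have "(\<lambda>x. phi x i) -` {c} \<inter> space ?M
          = - eventually_constant \<inter> (\<Union>n\<in>{1..}. {x. stake n x \<in> indexed_paths n (P n)})"
      proof (intro equalityI subsetI)
        fix x assume x: "x \<in> (\<lambda>x. phi x i) -` {c} \<inter> space ?M"
        then have ec: "x \<notin> eventually_constant" by (simp add: space_restrict_space)
        obtain n k p where n: "1 \<le> n" "at_position x n k p" "nat \<bar>i\<bar> + 1 \<le> p"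
            "p + (nat \<bar>i\<bar> + 1) \<le> length (block_of_paths n k)"
          using at_position_interior[OF ec] by blast
        then have "p \<in> P n k"
          using phi_at_position[OF n(1,2), of i] x by (auto simp: P_def)
        then show "x \<in> - eventually_constant \<inter> (\<Union>n\<in>{1..}. {x. stake n x \<in> indexed_paths n (P n)})"
          using n ec by (auto simp: stake_in_indexed_paths_iff)
      next
        fix x assume "x \<in> - eventually_constant \<inter> (\<Union>n\<in>{1..}. {x. stake n x \<in> indexed_paths n (P n)})"
        then show "x \<in> (\<lambda>x. phi x i) -` {c} \<inter> space ?M"
          using phi_at_position
          by (auto simp: stake_in_indexed_paths_iff P_def space_restrict_space)
      qed
      also have "\<dots> \<in> sets ?M"
      proof -
        have "(\<Union>n\<in>{1..}. {x. stake n x \<in> indexed_paths n (P n)}) \<in> sets (mu \<alpha>)"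
          by (intro sets.countable_UN' sets_mu_stake) auto
        then show ?thesis
          using sets_not_eventually_constant[OF assms] by (auto simp: sets_restrict_space_iff)
      qed
      finally show ?thesis .
    qed
    moreover have "finite (UNIV :: letter set)"
      by (rule finite_subset[of _ "{La, Lb}"]) (auto intro: letter.exhaust)
    ultimately show ?thesis by (subst measurable_count_space_eq2) auto
  qed
  then show "phi \<in> measurable ?M (PiM UNIV (\<lambda>_. count_space UNIV))"
    by (intro measurable_PiM_single') (auto simp: PiE_def)
qed

lemma nu_word_eq:
  assumes "0 < \<alpha>" "\<alpha> < 1"
  shows "nu_word \<alpha> B
      = measure (mu \<alpha>) {x. x \<notin> eventually_constant \<and> window (phi x) 0 (length B) = B}"
    and "{x. x \<notin> eventually_constant \<and> window (phi x) 0 (length B) = B} \<in> sets (mu \<alpha>)"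
proof -
  let ?M = "restrict_space (mu \<alpha>) (- eventually_constant)"
  let ?A = "{\<omega> \<in> Sigma_shift. window \<omega> 0 (length B) = B}"
  let ?Z = "{x. x \<notin> eventually_constant \<and> window (phi x) 0 (length B) = B}"
  note ec = sets_not_eventually_constant[OF assms]
  have "{\<omega>. window \<omega> 0 (length B) = B} = {\<omega>. \<forall>j<length B. \<omega> (int j) = B ! j}"
    by (intro Collect_cong, subst list_eq_iff_nth_eq) (simp add: window_def)
  also have "\<dots> \<in> sets (PiM UNIV (\<lambda>_::int. count_space (UNIV :: letter set)))"
  proof -
    have "{\<omega> \<in> space (PiM UNIV (\<lambda>_::int. count_space (UNIV :: letter set))). \<forall>j\<in>{..<length B}. \<omega> (int j) = B ! j}
        \<in> sets (PiM UNIV (\<lambda>_::int. count_space (UNIV :: letter set)))"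
      by measurable
    then show ?thesis by (simp add: space_PiM Ball_def)
  qed
  finally have A: "?A \<in> sets Sigma_space"
    by (auto simp: Sigma_space_def sets_restrict_space image_iff)
  have vim: "phi -` ?A \<inter> space ?M = ?Z"
    using phi_in_Sigma_shift by (auto simp: space_restrict_space)
  have "?Z \<in> sets ?M"
    using measurable_sets[OF measurable_phi[OF assms] A] vim by simp
  then show "?Z \<in> sets (mu \<alpha>)"
    using ec by (subst (asm) sets_restrict_space_iff) auto
  have "nu_word \<alpha> B = measure ?M ?Z"
    unfolding nu_word_def nu_def using measure_distr[OF measurable_phi[OF assms] A] vim by simp
  also have "\<dots> = measure (mu \<alpha>) ?Z"
    using ec by (intro measure_restrict_space) auto
  finally show "nu_word \<alpha> B = measure (mu \<alpha>) ?Z" .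
qed

section \<open>Squeezing the measure of a word\<close>

lemma lower_freq_le_nu_word:
  assumes "0 < \<alpha>" "\<alpha> < 1" "B \<noteq> []" "1 \<le> n"
  shows "lower_freq \<alpha> B n \<le> nu_word \<alpha> B"
proof -
  interpret prob_space "mu \<alpha>" by (rule prob_space_mu)
  let ?Z = "{x. x \<notin> eventually_constant \<and> window (phi x) 0 (length B) = B}"
  let ?P = "\<lambda>j. occurrences B (block_of_paths n j)"
  have lt: "p < length (paths n j)" if "p \<in> ?P j" for j p
    using subsetD[OF occurrences_subset_partial[OF assms(3)] that]
    by (simp add: partial_occurrences_def block_of_paths_def)
  \<comment> \<open>Eventually constant points of these cylinders are excluded from
    \<open>?Z\<close>, so the inclusion holds only up to the null set.\<close>
  have "{x. stake n x \<in> indexed_paths n ?P} \<subseteq> ?Z \<union> eventually_constant"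
  proof
    fix x assume "x \<in> {x. stake n x \<in> indexed_paths n ?P}"
    then obtain j p where "at_position x n j p" "p \<in> ?P j"
      by (auto simp: stake_in_indexed_paths_iff)
    then show "x \<in> ?Z \<union> eventually_constant"
      using window_phi_at_position[OF assms(4), of x j p 0 "length B"]
      by (auto simp: occurrences_def)
  qed
  then have "measure (mu \<alpha>) {x. stake n x \<in> indexed_paths n ?P} \<le> measure (mu \<alpha>) (?Z \<union> eventually_constant)"
    using nu_word_eq(2)[OF assms(1,2)] null_setsD2[OF null_sets_eventually_constant[OF assms(1,2)]]
    by (intro finite_measure_mono) auto
  also have "\<dots> = measure (mu \<alpha>) ?Z"
    using nu_word_eq(2)[OF assms(1,2)] null_sets_eventually_constant[OF assms(1,2)]
    by (rule measure_Un_null_set)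
  finally show ?thesis
    using measure_indexed_paths[OF assms(1,2) lt] nu_word_eq(1)[OF assms(1,2)]
    by (simp add: lower_freq_def)
qed

lemma prefix_window_phi:
  assumes "1 \<le> n" "at_position x n k p"
  shows "prefix (take m (drop p (block_of_paths n k))) (window (phi x) 0 m)"
proof -
  \<comment> \<open>The number of letters of the window that still lie inside the block; these are
    known whatever follows it.\<close>
  let ?l = "min m (length (block_of_paths n k) - p)"
  have "take m (drop p (block_of_paths n k)) = take ?l (drop p (block_of_paths n k))"
    by (simp add: min_def)
  also have "\<dots> = window (phi x) 0 ?l"
    using window_phi_at_position[OF assms, of 0 ?l] assms(2)
    by (auto simp: at_position_def block_of_paths_def min_def)
  also have "\<dots> = take ?l (window (phi x) 0 m)"
    by (simp add: window_def take_map)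
  finally show ?thesis by (metis take_is_prefix)
qed

text \<open>Every sequence has some position in row \<open>n\<close>. If its window at time 0 is
  \<open>B\<close>, the part of the window inside the block is a prefix of \<open>B\<close>, which
  makes that position a partial occurrence.\<close>

lemma nu_word_le_upper_freq:
  assumes "0 < \<alpha>" "\<alpha> < 1" "1 \<le> n"
  shows "nu_word \<alpha> B \<le> upper_freq \<alpha> B n"
proof -
  interpret prob_space "mu \<alpha>" by (rule prob_space_mu)
  let ?Z = "{x. x \<notin> eventually_constant \<and> window (phi x) 0 (length B) = B}"
  let ?P = "\<lambda>j. partial_occurrences B (block_of_paths n j)"
  have lt: "p < length (paths n j)" if "p \<in> ?P j" for j p
    using that by (auto simp: partial_occurrences_def block_of_paths_def)
  have "?Z \<subseteq> {x. stake n x \<in> indexed_paths n ?P}"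
  proof
    fix x assume x: "x \<in> ?Z"
    obtain j p where "at_position x n j p" using at_position_exists by blast
    moreover from this have "p \<in> ?P j"
      using x prefix_window_phi[OF assms(3), of x j p "length B"]
      by (simp add: partial_occurrences_def at_position_def block_of_paths_def)
    ultimately show "x \<in> {x. stake n x \<in> indexed_paths n ?P}"
      by (auto simp: stake_in_indexed_paths_iff)
  qed
  then have "measure (mu \<alpha>) ?Z \<le> measure (mu \<alpha>) {x. stake n x \<in> indexed_paths n ?P}"
    by (intro finite_measure_mono) auto
  then show ?thesis
    using measure_indexed_paths[OF assms(1,2) lt] nu_word_eq(1)[OF assms(1,2)]
    by (simp add: upper_freq_def)
qed

theorem theorem4p7:
  fixes B :: "letter list" and \<alpha> :: real and k :: "nat \<Rightarrow> nat"
  assumes "B \<in> lang"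
    and "0 < \<alpha>" and "\<alpha> < 1"
    and "\<And>n. 1 \<le> n \<Longrightarrow> k n \<le> n"
    and "filterlim k at_top sequentially"
    and "(\<lambda>n. real (k n) / real n) \<longlonglongrightarrow> \<alpha>"
  shows "(\<lambda>n. freq B (block n (k n))) \<longlonglongrightarrow> nu_word \<alpha> B"
proof -
  have "B \<noteq> []" using assms(1) by (simp add: lang_def)
  then show ?thesis
    using assms by (intro freq_block_tendsto[OF assms(2,3)] lower_freq_le_nu_word
      nu_word_le_upper_freq) simp_all
qed

end
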